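(* Let $q=3^n$ with $n$ a positive integer and let $t$ be any positive integer. Let $\alpha,\beta,\theta\in\mathbb{F}_q^*$ and define $f:\mathbb{F}_q\to\mathbb{F}_q$ by $f(0)=0$, $f(x)=\alpha x^t$ if $x\in C_0$, and $f(x)=\beta(x^3+\theta x^2+\theta^2x)$ if $x\in C_1$. Then $f$ is a permutation polynomial of $\mathbb{F}_q$ if and only if $\gcd\left(t,\frac{q-1}{2}\right)=1$, $\eta(\theta)=1$ and $\eta(\alpha)=\eta(\beta)$. In this case, $f$ is given on $\mathbb{F}_q$ by $$f(x)=(\beta x^3+\beta\theta x^2+\beta\theta^2x-\alpha x^t)x^{\frac{3^n-1}{2}}-(\beta x^3+\beta\theta x^2+\beta\theta^2x+\alpha x^t).$$
   Context: $C_0$ is the set of nonzero squares of $\mathbb{F}_q$ and $C_1$ the set of non-squares. $\eta$ is the quadratic character of $\mathbb{F}_q$ ($1$ on nonzero squares, $-1$ on non-squares). A map (or polynomial) is a permutation polynomial (PP) of $\mathbb{F}_q$ if it induces a bijection of $\mathbb{F}_q$. *)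

theory Defs
  imports "HOL-Computational_Algebra.Computational_Algebra" "HOL-Library.Cardinality"
begin

definition C0 :: "'a :: finite_field set" where
  "C0 = {x. x \<noteq> 0 \<and> is_square x}"

(* Since 0 is a square, C1 does not contain 0: the field is the disjoint union of {0}, C0 and C1. *)
definition C1 :: "'a :: finite_field set" where
  "C1 = {x. \<not> is_square x}"

definition quadratic_character :: "'a :: finite_field \<Rightarrow> int"  ("\<eta>") where
  "\<eta> x = (if x = 0 then 0 else if x \<in> C0 then 1 else - 1)"

(* "PP" is understood for maps: every self-map of a finite field is induced by a polynomial,
   and the condition concerns the induced map only. *)
definition permutation_polynomial :: "('a :: finite_field \<Rightarrow> 'a) \<Rightarrow> bool" where
  "permutation_polynomial f \<longleftrightarrow> bij f"

end

(* In characteristic 3 the cubic x^3 + theta x^2 + theta^2 x equals x (x - theta)^2.  If theta is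
   a non-square, it lies in C1 and is a nonzero root of f.  If theta is a square, the cubic maps C1
   into itself, and it is injective there because a collision at x <> y in C1 would make theta x a
   square.  So f sends C1 bijectively onto beta C1, and is a permutation iff x -> alpha x^t sends
   C0 bijectively onto beta C0. *)
theory Submission
  imports Defs
begin

section \<open>Fermat's theorem, the characteristic, and roots of unity\<close>

lemma finite_field_power_card_minus_1:
  fixes x :: "'a :: finite_field"
  assumes "x \<noteq> 0"
  shows "x ^ (CARD('a) - 1) = 1"
proof -
  have "x * x ^ (CARD('a) - 1) = x * 1"
    using finite_field_power_card_eq_same[of x] power_Suc[of x "CARD('a) - 1"]
    by (simp add: card_gt_0_iff)
  with assms show ?thesis by simp
qed

text \<open>Translation by 1 permutes the ring, so summing \<open>x + 1\<close> over all
  \<open>x\<close> gives the same total as summing \<open>x\<close>.\<close>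

lemma of_nat_CARD_eq_0: "of_nat CARD('a) = (0 :: 'a :: {finite, ring_1})"
proof -
  have "(\<Sum>x\<in>(UNIV :: 'a set). x + 1) = (\<Sum>x\<in>UNIV. x)"
    by (rule sum.reindex_bij_witness[of _ "\<lambda>x. x - 1" "\<lambda>x. x + 1"]) auto
  thus ?thesis by (simp add: sum.distrib)
qed

lemma card_roots_of_unity_le:
  assumes "k > 0"
  shows "card {x :: 'a :: idom. x ^ k = 1} \<le> k"
proof -
  define p where "p = monom (1 :: 'a) k - 1"
  have deg: "degree p = k"
    unfolding p_def using assms
    by (simp add: degree_monom_eq diff_conv_add_uminus degree_add_eq_left del: add_uminus_conv_diff)
  with assms have "p \<noteq> 0" by auto
  moreover have "{x. poly p x = 0} = {x. x ^ k = 1}"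
    by (auto simp: p_def poly_monom)
  ultimately show ?thesis using card_poly_roots_bound[of p] deg by simp
qed

section \<open>Squares and power maps in a field of odd order\<close>

context
  assumes odd_card: "odd CARD('a :: finite_field)"
begin

lemma one_neq_minus_one: "(1 :: 'a) \<noteq> - 1"
proof
  assume "(1 :: 'a) = - 1"
  hence "(2 :: 'a) = 0" by (metis add.right_inverse one_add_one)
  moreover from odd_card obtain k where "CARD('a) = 2 * k + 1" by (auto elim: oddE)
  ultimately have "of_nat CARD('a) = (1 :: 'a)" by simp
  thus False by (simp add: of_nat_CARD_eq_0)
qed

lemma half_card_pos: "(CARD('a) - 1) div 2 > 0"
proof -
  have "card {0, 1 :: 'a} \<le> CARD('a)" by (rule card_mono) auto
  with odd_card show ?thesis by (cases "CARD('a) = 2") auto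
qed

lemma double_half_card: "2 * ((CARD('a) - 1) div 2) = CARD('a) - 1"
  using odd_card by simp

text \<open>Euler's criterion by counting: by Fermat every nonzero square is a root of X^m - 1,
  which has at most m roots, and there are at least m nonzero squares.\<close>

lemma squares_eq_roots_of_unity: "C0 = {x :: 'a. x ^ ((CARD('a) - 1) div 2) = 1}"
proof (rule card_seteq)
  let ?m = "(CARD('a) - 1) div 2"
  show "C0 \<subseteq> {x :: 'a. x ^ ?m = 1}"
    using finite_field_power_card_minus_1 double_half_card
    by (auto simp: C0_def is_nth_power_def simp flip: power_mult)
  \<comment> \<open>The fibres of squaring over \<open>C0\<close> cover the 2m nonzero elements and
    have at most two elements each, hence at least m squares.\<close>
  have "CARD('a) - 1 = card (UNIV - {0 :: 'a})" by (simp add: card_Diff_subset)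
  also have "UNIV - {0} = (\<Union>y\<in>C0. {x :: 'a. x ^ 2 = y})" by (auto simp: C0_def)
  also have "card \<dots> \<le> (\<Sum>y\<in>C0. card {x :: 'a. x ^ 2 = y})" by (rule card_UN_le) simp
  also have "\<dots> \<le> (\<Sum>y\<in>(C0 :: 'a set). 2)"
  proof (rule sum_mono)
    fix y :: 'a assume "y \<in> C0"
    then obtain z where "y = z ^ 2" by (auto simp: C0_def is_nth_power_def)
    hence "{x. x ^ 2 = y} = {z, - z}" by (auto simp: power2_eq_iff)
    thus "card {x. x ^ 2 = y} \<le> 2" by (simp add: card_insert_if)
  qed
  finally have "?m \<le> card (C0 :: 'a set)" using double_half_card by simp
  with card_roots_of_unity_le[OF half_card_pos]
  show "card {x :: 'a. x ^ ?m = 1} \<le> card (C0 :: 'a set)" by (rule order_trans)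
qed simp

lemma is_square_iff_power:
  assumes "x \<noteq> (0 :: 'a)"
  shows "is_square x \<longleftrightarrow> x ^ ((CARD('a) - 1) div 2) = 1"
  using assms squares_eq_roots_of_unity by (auto simp: C0_def)

lemma nonsquare_power:
  assumes "\<not> is_square (x :: 'a)"
  shows "x ^ ((CARD('a) - 1) div 2) = - 1"
proof -
  let ?m = "(CARD('a) - 1) div 2"
  have "x \<noteq> 0" using assms by auto
  hence "(x ^ ?m) ^ 2 = 1"
    using finite_field_power_card_minus_1[of x] double_half_card
    by (metis mult.commute power_mult)
  moreover have "x ^ ?m \<noteq> 1" using assms is_square_iff_power \<open>x \<noteq> 0\<close> by simp
  ultimately show ?thesis by (simp add: power2_eq_1_iff)
qed

text \<open>The map \<open>x ^ m\<close> with m = (q - 1)/2 is multiplicative, and its values 1 and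
  -1 on squares and non-squares are distinct.\<close>

lemma is_square_mult_iff:
  assumes "x \<noteq> (0 :: 'a)" "y \<noteq> 0"
  shows "is_square (x * y) \<longleftrightarrow> (is_square x \<longleftrightarrow> is_square y)"
  using assms one_neq_minus_one nonsquare_power[of x] nonsquare_power[of y]
  by (cases "is_square x"; cases "is_square y")
    (simp_all add: is_square_iff_power power_mult_distrib)

text \<open>\<open>C0\<close> is a group of order m, so injectivity amounts to a trivial kernel.
  Root counting and Bezout's identity replace the choice of a generator.\<close>

lemma inj_on_power_squares_iff:
  "inj_on (\<lambda>x :: 'a. x ^ t) C0 \<longleftrightarrow> gcd t ((CARD('a) - 1) div 2) = 1"
proof
  let ?m = "(CARD('a) - 1) div 2"
  assume inj: "inj_on (\<lambda>x :: 'a. x ^ t) C0"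
  define d where "d = gcd t ?m"
  obtain k where k: "?m = d * k" unfolding d_def by (metis dvdE gcd_dvd2)
  have "d = 1"
  proof (rule ccontr)
    assume "d \<noteq> 1"
    have pos: "d > 0" "k > 0" using half_card_pos k by auto
    \<comment> \<open>A nontrivial kernel element is sought as \<open>y ^ (2 * k)\<close>: it is a
      square, and its \<open>t\<close>-th power is 1 because \<open>d\<close> divides
      \<open>t\<close> and \<open>2 * d * k\<close> is q - 1. As \<open>d > 1\<close>, X^(2k) - 1
      has too few roots to kill every nonzero \<open>y\<close>.\<close>
    have "card {y :: 'a. y ^ (2 * k) = 1} \<le> 2 * k"
      using card_roots_of_unity_le[of "2 * k"] pos by simp
    also have "\<dots> < 2 * ?m" using k pos \<open>d \<noteq> 1\<close> by simp
    also have "\<dots> = card (UNIV - {0 :: 'a})"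
      unfolding double_half_card by (simp add: card_Diff_subset)
    finally have "\<not> UNIV - {0} \<subseteq> {y :: 'a. y ^ (2 * k) = 1}"
      by (metis card_mono finite leD)
    then obtain y :: 'a where y: "y \<noteq> 0" "y ^ (2 * k) \<noteq> 1" by auto
    have "y ^ (2 * k) \<in> C0"
      using y by (auto simp: C0_def is_nth_power_def mult.commute power_mult)
    moreover have "(y ^ (2 * k)) ^ t = 1"
    proof -
      obtain j where j: "t = d * j" unfolding d_def by (metis dvdE gcd_dvd1)
      have "2 * k * t = 2 * ?m * j" using j k by simp
      thus ?thesis using finite_field_power_card_minus_1[OF y(1)] double_half_card
        by (metis power_mult power_one)
    qed
    moreover have "(1 :: 'a) \<in> C0" by (simp add: C0_def)
    ultimately show False using inj_onD[OF inj, of "y ^ (2 * k)" 1] y(2) by simp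
  qed
  thus "gcd t ?m = 1" by (simp add: d_def)
next
  let ?m = "(CARD('a) - 1) div 2"
  assume gcd: "gcd t ?m = 1"
  show "inj_on (\<lambda>x :: 'a. x ^ t) C0"
  proof (rule inj_onI)
    fix x y :: 'a assume xy: "x \<in> C0" "y \<in> C0" "x ^ t = y ^ t"
    define z where "z = x / y"
    have nz: "y \<noteq> 0" using xy by (simp add: C0_def)
    have zt: "z ^ t = 1" using xy nz by (simp add: z_def power_divide)
    have zm: "z ^ ?m = 1"
      using xy(1,2) nz by (simp add: squares_eq_roots_of_unity z_def power_divide)
    \<comment> \<open>Bezout's identity in a form free of subtraction on naturals; both
      \<open>z ^ (?m * a)\<close> and \<open>z ^ (t * b)\<close> are 1.\<close>
    obtain a b where "?m * a = t * b + 1"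
      using bezout_nat[of ?m t] half_card_pos gcd by (auto simp: gcd.commute)
    hence "z ^ (?m * a) = z ^ (t * b) * z" by simp
    hence "z = 1" using zt zm by (simp add: power_mult)
    thus "x = y" using nz by (simp add: z_def)
  qed
qed

end

section \<open>The cubic in characteristic 3\<close>

context
  assumes char3: "(3 :: 'a :: finite_field) = 0"
begin

lemma cubic_eq: "x ^ 3 + \<theta> * x ^ 2 + \<theta> ^ 2 * x = x * (x - \<theta> :: 'a) ^ 2"
proof -
  have "x * (x - \<theta>) ^ 2 = x ^ 3 + \<theta> * x ^ 2 + \<theta> ^ 2 * x - 3 * (\<theta> * x ^ 2)"
    by (simp add: power2_eq_square power3_eq_cube algebra_simps)
  thus ?thesis by (simp add: char3)
qed

text \<open>For \<open>d = x - y \<noteq> 0\<close>, equal values force \<open>d\<^sup>2 + \<theta> (x + y) + \<theta>\<^sup>2 = 0\<close>;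
  solving this together with \<open>x - y = d\<close> gives \<open>\<theta> x = (d + \<theta>)\<^sup>2\<close>.\<close>

lemma cubic_collision:
  fixes x y \<theta> :: 'a
  assumes "x ^ 3 + \<theta> * x ^ 2 + \<theta> ^ 2 * x = y ^ 3 + \<theta> * y ^ 2 + \<theta> ^ 2 * y" "x \<noteq> y"
  shows "\<theta> * x = (x - y + \<theta>) ^ 2"
proof -
  \<comment> \<open>A polynomial identity over any commutative ring. The multiple of 3 arises from
    replacing \<open>x ^ 2 + x * y + y ^ 2\<close> by \<open>(x - y) ^ 2\<close> and
    \<open>\<theta> * (x + y)\<close> by \<open>\<theta> * (x - 2 * y)\<close>.\<close>
  have "(x - y) * ((x - y + \<theta>) ^ 2 - \<theta> * x) =
      (x ^ 3 + \<theta> * x ^ 2 + \<theta> ^ 2 * x) - (y ^ 3 + \<theta> * y ^ 2 + \<theta> ^ 2 * y)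
      - 3 * (x - y) * (x * y + \<theta> * y)"
    by (simp add: power2_eq_square power3_eq_cube algebra_simps)
  also have "\<dots> = 0" using assms char3 by simp
  finally show ?thesis using assms(2) by simp
qed

end

section \<open>The permutation criterion and the closed formula\<close>

theorem theorem2p6:
  fixes \<alpha> \<beta> \<theta> :: "'a :: finite_field"
    and f :: "'a \<Rightarrow> 'a"
    and n t :: nat
  assumes "n > 0" and "CARD('a) = 3 ^ n"
    and "t > 0"
    and "\<alpha> \<noteq> 0" and "\<beta> \<noteq> 0" and "\<theta> \<noteq> 0"
    and "f 0 = 0"
    and "\<And>x. x \<in> C0 \<Longrightarrow> f x = \<alpha> * x ^ t"
    and "\<And>x. x \<in> C1 \<Longrightarrow> f x = \<beta> * (x ^ 3 + \<theta> * x ^ 2 + \<theta> ^ 2 * x)"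
  shows "(permutation_polynomial f \<longleftrightarrow>
            gcd t ((CARD('a) - 1) div 2) = 1 \<and> \<eta> \<theta> = 1 \<and> \<eta> \<alpha> = \<eta> \<beta>) \<and>
         (permutation_polynomial f \<longrightarrow>
            (\<forall>x. f x =
               (\<beta> * x ^ 3 + \<beta> * \<theta> * x ^ 2 + \<beta> * \<theta> ^ 2 * x - \<alpha> * x ^ t) * x ^ ((3 ^ n - 1) div 2)
               - (\<beta> * x ^ 3 + \<beta> * \<theta> * x ^ 2 + \<beta> * \<theta> ^ 2 * x + \<alpha> * x ^ t)))"
proof -
  let ?m = "(CARD('a) - 1) div 2"
  have "(3 :: 'a) ^ n = 0" using of_nat_CARD_eq_0[where 'a = 'a] assms(2) by simp
  hence char3: "(3 :: 'a) = 0" by simp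
  have odd: "odd CARD('a)" using assms(2) by simp
  note mult_iff = is_square_mult_iff[OF odd]
  define g where "g x = x ^ 3 + \<theta> * x ^ 2 + \<theta> ^ 2 * x" for x
  have f1: "f x = \<beta> * g x" if "x \<in> C1" for x using assms(9) that by (simp add: g_def)
  have g_eq: "g x = x * (x - \<theta>) ^ 2" for x
    unfolding g_def by (rule cubic_eq[OF char3])
  have cases: "x = 0 \<or> x \<in> C0 \<or> x \<in> C1" for x :: 'a by (auto simp: C0_def C1_def)
  have eta: "\<eta> x = \<eta> y \<longleftrightarrow> (is_square x \<longleftrightarrow> is_square y)" if "x \<noteq> 0" "y \<noteq> 0" for x y :: 'a
    using that by (simp add: quadratic_character_def C0_def)
  have eta1: "\<eta> \<theta> = 1 \<longleftrightarrow> is_square \<theta>"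
    using assms(6) by (simp add: quadratic_character_def C0_def)
  have pow_C0: "x ^ t \<in> C0" if "x \<in> C0" for x :: 'a
    using that by (auto simp: C0_def is_nth_power_def simp flip: power_mult)
      (metis mult.commute power_mult)
  \<comment> \<open>Here \<open>x\<close> differs from the square \<open>\<theta>\<close>, so
    \<open>g x\<close> is \<open>x\<close> times a nonzero square.\<close>
  have g_C1: "g x \<in> C1" if "x \<in> C1" "is_square \<theta>" for x
  proof -
    have "x \<noteq> 0" "x - \<theta> \<noteq> 0" using that by (auto simp: C1_def)
    with that(1) show ?thesis by (simp add: C1_def g_eq mult_iff)
  qed
  have g_inj: "inj_on g C1" if "is_square \<theta>"
  proof (rule inj_onI, rule ccontr)
    fix x y assume xy: "x \<in> C1" "y \<in> C1" "g x = g y" "x \<noteq> y"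
    have "\<theta> * x = (x - y + \<theta>) ^ 2"
      by (rule cubic_collision[OF char3]) (use xy in \<open>simp_all add: g_def\<close>)
    hence "is_square (\<theta> * x)" by simp
    moreover have "x \<noteq> 0" using xy by (auto simp: C1_def)
    ultimately show False using that xy(1) assms(6) by (simp add: mult_iff C1_def)
  qed
  have iff: "bij f \<longleftrightarrow> gcd t ?m = 1 \<and> \<eta> \<theta> = 1 \<and> \<eta> \<alpha> = \<eta> \<beta>"
  proof
    assume "bij f"
    hence inj: "inj f" by (rule bij_is_inj)
    have "inj_on (\<lambda>x. x ^ t) (C0 :: 'a set)"
    proof (rule inj_onI)
      fix x y :: 'a assume "x \<in> C0" "y \<in> C0" "x ^ t = y ^ t"
      hence "f x = f y" by (simp add: assms(8))
      with inj show "x = y" by (rule injD)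
    qed
    hence "gcd t ?m = 1" by (simp add: inj_on_power_squares_iff[OF odd])
    moreover have sq: "is_square \<theta>"
    proof (rule ccontr)
      assume "\<not> is_square \<theta>"
      hence "f \<theta> = f 0" by (simp add: f1 C1_def g_eq assms(7))
      thus False using inj assms(6) by (auto dest: injD)
    qed
    \<comment> \<open>Otherwise \<open>\<alpha> / \<beta>\<close> is a non-square, hence a value
      \<open>g y\<close> with \<open>y\<close> in \<open>C1\<close>, and
      \<open>f y = \<alpha> = f 1\<close> although 1 lies in \<open>C0\<close>.\<close>
    moreover have "is_square \<alpha> \<longleftrightarrow> is_square \<beta>"
    proof (rule ccontr)
      assume ne: "\<not> ?thesis"
      have "g ` C1 = C1"
        by (rule endo_inj_surj) (use g_C1 g_inj sq in auto)
      moreover have "\<alpha> / \<beta> \<in> C1"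
      proof -
        have "is_square (\<beta> * (\<alpha> / \<beta>)) \<longleftrightarrow> (is_square \<beta> \<longleftrightarrow> is_square (\<alpha> / \<beta>))"
          using assms(4,5) by (intro mult_iff) auto
        with ne assms(5) show ?thesis by (auto simp: C1_def)
      qed
      ultimately obtain y where y: "y \<in> C1" "g y = \<alpha> / \<beta>" by force
      have "1 \<in> (C0 :: 'a set)" by (simp add: C0_def)
      hence "f y = f 1" using y assms(5) by (simp add: f1 assms(8))
      hence "y = 1" using inj by (rule injD[rotated])
      with y(1) show False by (simp add: C1_def)
    qed
    ultimately show "gcd t ?m = 1 \<and> \<eta> \<theta> = 1 \<and> \<eta> \<alpha> = \<eta> \<beta>"
      using eta eta1 assms(4,5) by simp
  next
    assume R: "gcd t ?m = 1 \<and> \<eta> \<theta> = 1 \<and> \<eta> \<alpha> = \<eta> \<beta>"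
    hence sq: "is_square \<theta>" and ab: "is_square \<alpha> \<longleftrightarrow> is_square \<beta>"
      using eta eta1 assms(4,5) by auto
    have inj0: "inj_on (\<lambda>x. x ^ t) (C0 :: 'a set)"
      using R by (simp add: inj_on_power_squares_iff[OF odd])
    \<comment> \<open>The images of \<open>C0\<close> and \<open>C1\<close> lie in opposite
      quadratic classes and avoid 0, so a collision can only occur within one piece.\<close>
    have f_C0: "f x \<noteq> 0 \<and> (is_square (f x) \<longleftrightarrow> is_square \<alpha>)" if "x \<in> C0" for x
      using pow_C0[OF that] assms(4,8) that mult_iff[of \<alpha> "x ^ t"] by (simp add: C0_def)
    have f_C1: "f x \<noteq> 0 \<and> (is_square (f x) \<longleftrightarrow> \<not> is_square \<alpha>)" if "x \<in> C1" for x
    proof -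
      have "g x \<noteq> 0" "\<not> is_square (g x)" using g_C1[OF that sq] by (auto simp: C1_def)
      thus ?thesis using assms(5) ab by (simp add: f1[OF that] mult_iff)
    qed
    have "inj f"
    proof (rule injI)
      fix x y assume eq: "f x = f y"
      consider "x = 0" "y = 0" | "x \<in> C0" "y \<in> C0" | "x \<in> C1" "y \<in> C1"
        using cases[of x] cases[of y] f_C0[of x] f_C0[of y] f_C1[of x] f_C1[of y] eq assms(7)
        by metis
      thus "x = y"
      proof cases
        case 2
        with eq assms(4) have "x ^ t = y ^ t" by (simp add: assms(8))
        with inj0 2 show ?thesis by (auto dest: inj_onD)
      next
        case 3
        with eq assms(5) have "g x = g y" by (simp add: f1)
        with g_inj[OF sq] 3 show ?thesis by (auto dest: inj_onD)
      qed auto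
    qed
    thus "bij f" by (simp add: bij_def finite_UNIV_inj_surj)
  qed
  \<comment> \<open>The right side collapses to \<open>- 2 * \<alpha> * x ^ t\<close> on
    \<open>C0\<close>, where \<open>x ^ ?m\<close> is 1, and to \<open>- 2 * \<beta> * g x\<close>
    on \<open>C1\<close>, where it is -1; moreover -2 = 1.\<close>
  have formula: "f x =
      (\<beta> * x ^ 3 + \<beta> * \<theta> * x ^ 2 + \<beta> * \<theta> ^ 2 * x - \<alpha> * x ^ t) * x ^ ?m
      - (\<beta> * x ^ 3 + \<beta> * \<theta> * x ^ 2 + \<beta> * \<theta> ^ 2 * x + \<alpha> * x ^ t)" for x
  proof -
    have minus2: "z = - (2 * z)" for z :: 'a
    proof -
      have "z + 2 * z = 3 * z" by simp
      thus ?thesis using char3 by (simp only: mult_zero_left eq_neg_iff_add_eq_0)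
    qed
    consider "x = 0" | "x \<in> C0" | "x \<in> C1" using cases by blast
    thus ?thesis
    proof cases
      case 1
      \<comment> \<open>As \<open>0 ^ 0 = 1\<close>, the value 0 at the origin relies on
        \<open>t > 0\<close>.\<close>
      thus ?thesis using assms(3,7) half_card_pos[OF odd] by (simp add: zero_power)
    next
      case 2
      hence "x ^ ?m = 1" using squares_eq_roots_of_unity[OF odd] by auto
      thus ?thesis using minus2[of "\<alpha> * x ^ t"] by (simp add: assms(8)[OF 2])
    next
      case 3
      hence "x ^ ?m = - 1" using nonsquare_power[OF odd] by (simp add: C1_def)
      thus ?thesis using minus2[of "\<beta> * g x"]
        by (simp add: f1[OF 3] g_def algebra_simps)
    qed
  qed
  show ?thesis
    using iff formula assms(2) by (simp add: permutation_polynomial_def)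
qed

end
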